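(* Let $\mathcal{C}$ be the set of maximal cliques of a finite undirected graph $(V,E)$, and let $\mathcal{G}=\bigcup_{C\in\mathcal{C}}\mathcal{G}_C$ be the corresponding UGM hypergraph. Suppose that the rank $r$ of $\mathcal{G}$ satisfies $r\ge 3$. Then the clique relaxation is strictly contained in the running intersection relaxation: $\mathrm{MP}^{\mathrm{cl}}(\mathcal{G})\subsetneq \mathrm{MP}^{\mathrm{RI}}(\mathcal{G})$.
   Context: A hypergraph $\mathcal{G}=(V,\mathcal{E})$ has a finite node set $V$ and a set $\mathcal{E}$ of edges, which are subsets of $V$ of cardinality at least two. Its rank is the maximum cardinality of an edge. For a node $v$, $z_{\{v\}}$ means $z_v$. UGM hypergraph: let $\mathcal{C}$ be the set of maximal cliques (with respect to inclusion) of a finite undirected graph with node set $V$. For $C\in\mathcal{C}$ let $\bar P(C)$ be the set of all subsets of $C$ of cardinality at least two. The UGM hypergraph is $\mathcal{G}=(V,\mathcal{E})$ with $\mathcal{E}=\bigcup_{C\in\mathcal{C}}\bar P(C)$. Writing $\mathcal{G}_C=(C,\bar P(C))$ for the complete hypergraph with node set $C$, we have $\mathcal{G}=\bigcup_{C\in\mathcal{C}}\mathcal{G}_C$ (union of node sets and of edge sets). Multilinear polytope: for a hypergraph $\mathcal{G}=(V,\mathcal{E})$, $S(\mathcal{G})=\{z\in\{0,1\}^{V\cup\mathcal{E}}: z_e=\prod_{v\in e}z_v\ \forall e\in\mathcal{E}\}$ and $\mathrm{MP}(\mathcal{G})=\mathrm{conv}(S(\mathcal{G}))$. Clique relaxation: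 $\mathrm{MP}^{\mathrm{cl}}(\mathcal{G})$ is the set of $z\in\mathbb{R}^{V\cup\mathcal{E}}$ such that for every $C\in\mathcal{C}$ the restriction of $z$ to the coordinates indexed by the nodes and edges of $\mathcal{G}_C$ lies in $\mathrm{MP}(\mathcal{G}_C)$. Standard linearization: $\mathrm{MP}^{\mathrm{LP}}(\mathcal{G})$ is the set of $z\in\mathbb{R}^{V\cup\mathcal{E}}$ with $z_v\le 1$ for all $v\in V$, and $z_e\ge 0$, $z_e\ge\sum_{v\in e}z_v-|e|+1$, $z_e\le z_v$ $(v\in e)$ for all $e\in\mathcal{E}$. Flower inequalities: let $e_0$, $e_k$ ($k\in T$, $T\ne\emptyset$) be edges of $\mathcal{G}$ with $|(e_0\cap e_k)\setminus\bigcup_{j\in T\setminus\{k\}}(e_0\cap e_j)|\ge 2$ for all $k\in T$. The flower inequality centered at $e_0$ with neighbors $e_k$, $k\in T$, is $$\sum_{v\in e_0\setminus\bigcup_{k\in T}e_k}z_v+\sum_{k\in T}z_{e_k}-z_{e_0}\le \Big|e_0\setminus\bigcup_{k\in T}e_k\Big|+|T|-1.$$ The flower relaxation $\mathrm{MP}^{F}(\mathcal{G})$ is obtained by adding all flower inequalities, for every center edge, to $\mathrm{MP}^{\mathrm{LP}}(\mathcal{G})$. Running intersection property: a set $F$ of subsets of a finite set has the running intersection property if its members can be ordered $p_1,\dots,p_m$ (a running intersection ordering) such that for each $k=2,\dots,m$ there is $j<k$ with $p_k\cap(\bigcup_{i<k}p_i)\subseteq p_j$. Such an ordering induces sets $N(p_1)=\emptyset$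 and $N(p_k)=p_k\cap(\bigcup_{i<k}p_i)$ for $k\ge 2$. Running intersection inequalities: let $e_0$, $e_k$ ($k\in T$, $T\neq\emptyset$) be edges of $\mathcal{G}$ such that (i) $|e_0\cap e_k|\ge 2$ for all $k\in T$; (ii) $e_0\cap e_k\not\subseteq e_0\cap e_{k'}$ for all $k\ne k'$ in $T$; (iii) $\tilde E=\{e_0\cap e_k:k\in T\}$ has the running intersection property. For any running intersection ordering of $\tilde E$ with induced sets $N(e_0\cap e_k)$, and any choice of $w_k\subseteq N(e_0\cap e_k)$, $k\in T$, where each $w_k$ is either empty, a single node, or an edge of $\mathcal{G}$, the corresponding running intersection inequality is $$-\sum_{k\in T}z_{w_k}+\sum_{v\in e_0\setminus\bigcup_{k\in T}e_k}z_v+\sum_{k\in T}z_{e_k}-z_{e_0}\le\omega-1,$$ where $z_\emptyset:=0$ and $\omega=|e_0\setminus\bigcup_{k\in T}e_k|+|\{k\in T:w_k=\emptyset\}|$. The running intersection relaxation $\mathrm{MP}^{\mathrm{RI}}(\mathcal{G})$ is obtained by adding all running intersection inequalities to $\mathrm{MP}^{F}(\mathcal{G})$. *)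

theory Defs
  imports
    "HOL-Analysis.Analysis"
    "HOL-Library.Function_Algebras"
    "HOL-Library.Ramsey"
begin

instantiation "fun" :: (type, real_vector) real_vector
begin

definition scaleR_fun :: "real \<Rightarrow> ('a \<Rightarrow> 'b) \<Rightarrow> 'a \<Rightarrow> 'b"
  where "scaleR_fun c f = (\<lambda>x. c *\<^sub>R f x)"

instance
  by standard (simp_all add: scaleR_fun_def fun_eq_iff scaleR_add_right scaleR_add_left)

end

record 'a hypergraph =
  nodes :: "'a set"
  edges :: "'a set set"

definition hypergraph :: "'a hypergraph \<Rightarrow> bool"
  where "hypergraph G \<longleftrightarrow> finite (nodes G) \<and> (\<forall>e\<in>edges G. e \<subseteq> nodes G \<and> card e \<ge> 2)"

text \<open>Without edges the maximum cardinality is taken to be zero.\<close>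
definition rank_hg :: "'a hypergraph \<Rightarrow> nat"
  where "rank_hg G = (if edges G = {} then 0 else Max (card ` edges G))"

definition subsets_ge2 :: "'a set \<Rightarrow> 'a set set"
  where "subsets_ge2 C = {e. e \<subseteq> C \<and> card e \<ge> 2}"

definition complete_hg :: "'a set \<Rightarrow> 'a hypergraph"
  where "complete_hg C = \<lparr>nodes = C, edges = subsets_ge2 C\<rparr>"

definition Union_hg :: "'a hypergraph set \<Rightarrow> 'a hypergraph"
  where "Union_hg H = \<lparr>nodes = (\<Union>G\<in>H. nodes G), edges = (\<Union>G\<in>H. edges G)\<rparr>"

definition finite_graph :: "'a set \<Rightarrow> 'a set set \<Rightarrow> bool"
  where "finite_graph V E \<longleftrightarrow> finite V \<and> E \<subseteq> nsets V 2"

definition maximal_cliques :: "'a set \<Rightarrow> 'a set set \<Rightarrow> 'a set set"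
  where "maximal_cliques V E =
    {C. C \<subseteq> V \<and> clique C E \<and> (\<forall>D. D \<subseteq> V \<and> clique D E \<and> C \<subseteq> D \<longrightarrow> D = C)}"

definition ugm_hg :: "'a set \<Rightarrow> 'a set set \<Rightarrow> 'a hypergraph"
  where "ugm_hg V E = \<lparr>nodes = V, edges = (\<Union>C\<in>maximal_cliques V E. subsets_ge2 C)\<rparr>"

lemma ex_maximal_clique:
  assumes "finite V" "K \<subseteq> V" "clique K E"
  shows "\<exists>C\<in>maximal_cliques V E. K \<subseteq> C"
proof -
  let ?A = "{D. D \<subseteq> V \<and> clique D E}"
  have fin: "finite ?A" using assms(1) by simp
  have K: "K \<in> ?A" using assms by simp
  from finite_has_maximal2[OF fin K]
  obtain C where C: "C \<in> ?A" "K \<subseteq> C" "\<forall>D\<in>?A. C \<subseteq> D \<longrightarrow> C = D"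
    by (elim bexE conjE)
  then have "C \<in> maximal_cliques V E" by (auto simp: maximal_cliques_def)
  with C(2) show ?thesis by blast
qed

lemma ugm_hg_eq_Union:
  assumes "finite_graph V E"
  shows "ugm_hg V E = Union_hg (complete_hg ` maximal_cliques V E)"
proof -
  have "V = (\<Union>C\<in>maximal_cliques V E. C)"
  proof
    show "V \<subseteq> (\<Union>C\<in>maximal_cliques V E. C)"
    proof
      fix v assume "v \<in> V"
      then obtain C where "C \<in> maximal_cliques V E" "{v} \<subseteq> C"
        using ex_maximal_clique[of V "{v}" E] assms
        by (auto simp: finite_graph_def clique_def)
      then show "v \<in> (\<Union>C\<in>maximal_cliques V E. C)" by blast
    qed
  qed (auto simp: maximal_cliques_def)
  then show ?thesis by (simp add: ugm_hg_def Union_hg_def complete_hg_def)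
qed

lemma hypergraph_ugm_hg:
  assumes "finite_graph V E"
  shows "hypergraph (ugm_hg V E)"
  using assms
  by (auto simp: hypergraph_def ugm_hg_def finite_graph_def subsets_ge2_def maximal_cliques_def)

text \<open>
  A node \<open>v\<close> is identified with the coordinate \<open>{v}\<close>, which is never an edge.  The space of real
  vectors indexed by nodes and edges is the space of functions on sets vanishing off these coordinates.
\<close>
definition coords :: "'a hypergraph \<Rightarrow> 'a set set"
  where "coords G = (\<lambda>v. {v}) ` nodes G \<union> edges G"

definition coord_space :: "'a hypergraph \<Rightarrow> ('a set \<Rightarrow> real) set"
  where "coord_space G = {z. \<forall>i. i \<notin> coords G \<longrightarrow> z i = 0}"

definition restrict_coords :: "'a hypergraph \<Rightarrow> ('a set \<Rightarrow> real) \<Rightarrow> 'a set \<Rightarrow> real"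
  where "restrict_coords G z = (\<lambda>i. if i \<in> coords G then z i else 0)"

definition multilinear_set :: "'a hypergraph \<Rightarrow> ('a set \<Rightarrow> real) set"
  where "multilinear_set G =
    {z \<in> coord_space G. (\<forall>i\<in>coords G. z i \<in> {0, 1}) \<and> (\<forall>e\<in>edges G. z e = (\<Prod>v\<in>e. z {v}))}"

definition MP :: "'a hypergraph \<Rightarrow> ('a set \<Rightarrow> real) set"
  where "MP G = convex hull (multilinear_set G)"

definition MP_cl :: "'a set \<Rightarrow> 'a set set \<Rightarrow> ('a set \<Rightarrow> real) set"
  where "MP_cl V E =
    {z \<in> coord_space (ugm_hg V E).
      \<forall>C\<in>maximal_cliques V E. restrict_coords (complete_hg C) z \<in> MP (complete_hg C)}"

definition MP_LP :: "'a hypergraph \<Rightarrow> ('a set \<Rightarrow> real) set"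
  where "MP_LP G =
    {z \<in> coord_space G.
      (\<forall>v\<in>nodes G. z {v} \<le> 1) \<and>
      (\<forall>e\<in>edges G. z e \<ge> 0 \<and> z e \<ge> (\<Sum>v\<in>e. z {v}) - real (card e) + 1 \<and> (\<forall>v\<in>e. z e \<le> z {v}))}"

text \<open>
  Neighbors are indexed by finite nonempty sets of natural numbers.  The conditions below force the
  neighbors to be pairwise distinct, so this covers all finite families.
\<close>
definition flower :: "'a hypergraph \<Rightarrow> 'a set \<Rightarrow> nat set \<Rightarrow> (nat \<Rightarrow> 'a set) \<Rightarrow> bool"
  where "flower G e0 T e \<longleftrightarrow>
    e0 \<in> edges G \<and> finite T \<and> T \<noteq> {} \<and> (\<forall>k\<in>T. e k \<in> edges G) \<and>
    (\<forall>k\<in>T. card ((e0 \<inter> e k) - (\<Union>j\<in>T - {k}. e0 \<inter> e j)) \<ge> 2)"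

definition MP_F :: "'a hypergraph \<Rightarrow> ('a set \<Rightarrow> real) set"
  where "MP_F G =
    {z \<in> MP_LP G.
      \<forall>e0 T e. flower G e0 T e \<longrightarrow>
        (\<Sum>v\<in>e0 - (\<Union>k\<in>T. e k). z {v}) + (\<Sum>k\<in>T. z (e k)) - z e0
          \<le> real (card (e0 - (\<Union>k\<in>T. e k))) + real (card T) - 1}"

definition ri_ordering :: "'a set list \<Rightarrow> 'a set set \<Rightarrow> bool"
  where "ri_ordering ps F \<longleftrightarrow>
    distinct ps \<and> set ps = F \<and>
    (\<forall>k\<in>{1..<length ps}. \<exists>j<k. ps ! k \<inter> (\<Union>i<k. ps ! i) \<subseteq> ps ! j)"

definition running_intersection_property :: "'a set set \<Rightarrow> bool"
  where "running_intersection_property F \<longleftrightarrow> (\<exists>ps. ri_ordering ps F)"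

text \<open>
  \<open>takeWhile\<close> yields the members listed before \<open>p\<close>; for the first member the result is empty.
\<close>
definition ri_induced :: "'a set list \<Rightarrow> 'a set \<Rightarrow> 'a set"
  where "ri_induced ps p = p \<inter> \<Union> (set (takeWhile (\<lambda>q. q \<noteq> p) ps))"

lemma ri_induced_nth:
  assumes "distinct ps" "k < length ps"
  shows "ri_induced ps (ps ! k) = ps ! k \<inter> (\<Union>i<k. ps ! i)"
proof -
  have "takeWhile (\<lambda>q. q \<noteq> ps ! k) ps = take k ps"
    using assms by (intro takeWhile_eq_take_P_nth) (auto simp: nth_eq_iff_index_eq)
  moreover have "set (take k ps) = (!) ps ` {..<k}"
    using assms by (simp add: nth_image[symmetric] lessThan_atLeast0)
  ultimately show ?thesis by (simp add: ri_induced_def)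
qed

definition ri_neighbors :: "'a hypergraph \<Rightarrow> 'a set \<Rightarrow> nat set \<Rightarrow> (nat \<Rightarrow> 'a set) \<Rightarrow> bool"
  where "ri_neighbors G e0 T e \<longleftrightarrow>
    e0 \<in> edges G \<and> finite T \<and> T \<noteq> {} \<and> (\<forall>k\<in>T. e k \<in> edges G) \<and>
    (\<forall>k\<in>T. card (e0 \<inter> e k) \<ge> 2) \<and>
    (\<forall>k\<in>T. \<forall>k'\<in>T. k \<noteq> k' \<longrightarrow> \<not> e0 \<inter> e k \<subseteq> e0 \<inter> e k') \<and>
    running_intersection_property ((\<lambda>k. e0 \<inter> e k) ` T)"

definition ri_choice ::
  "'a hypergraph \<Rightarrow> 'a set \<Rightarrow> nat set \<Rightarrow> (nat \<Rightarrow> 'a set) \<Rightarrow> 'a set list \<Rightarrow> (nat \<Rightarrow> 'a set) \<Rightarrow> bool"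
  where "ri_choice G e0 T e ps w \<longleftrightarrow>
    (\<forall>k\<in>T. w k \<subseteq> ri_induced ps (e0 \<inter> e k) \<and>
           (w k = {} \<or> (\<exists>v\<in>nodes G. w k = {v}) \<or> w k \<in> edges G))"

definition MP_RI :: "'a hypergraph \<Rightarrow> ('a set \<Rightarrow> real) set"
  where "MP_RI G =
    {z \<in> MP_F G.
      \<forall>e0 T e ps w.
        ri_neighbors G e0 T e \<and> ri_ordering ps ((\<lambda>k. e0 \<inter> e k) ` T) \<and> ri_choice G e0 T e ps w \<longrightarrow>
        - (\<Sum>k\<in>T. if w k = {} then 0 else z (w k))
          + (\<Sum>v\<in>e0 - (\<Union>k\<in>T. e k). z {v}) + (\<Sum>k\<in>T. z (e k)) - z e0
          \<le> real (card (e0 - (\<Union>k\<in>T. e k))) + real (card {k\<in>T. w k = {}}) - 1}"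

end

theory Submission
  imports Defs
begin

text \<open>
  Containment.  A linear inequality holds on the polytope of a complete hypergraph on \<open>C\<close> as soon as
  it holds at the 0/1 points, where \<open>z\<^sub>S\<close> just says that every node of \<open>S\<close> has value one.  A running
  intersection inequality with center \<open>e\<^sub>0\<close> may have neighbors that leave every clique \<open>C\<close> around
  \<open>e\<^sub>0\<close>, but the cut-off sets \<open>e\<^sub>0 \<inter> e\<^sub>k\<close> are coordinates of \<open>C\<close>, and \<open>z\<^bsub>e\<^sub>k\<^esub> \<le> z\<^bsub>e\<^sub>0 \<inter> e\<^sub>k\<^esub>\<close> holds inside a
  clique containing \<open>e\<^sub>k\<close> (\<open>MP_cl_antimono\<close>).  So it suffices to check the inequality with
  \<open>e\<^sub>0 \<inter> e\<^sub>k\<close> in place of \<open>e\<^sub>k\<close> at 0/1 points (\<open>ri_inequality_01\<close>): going along the ordering, the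
  first set that contains a zero has all its predecessors equal to one, hence also its \<open>w\<^sub>k\<close>, and this
  set provides the missing unit.  Flower inequalities are the instance in which all
  \<open>w\<^sub>k\<close> are empty.

  Strictness.  The point with all nodes \<open>1/2\<close> and all edges \<open>0\<close> satisfies every inequality of the
  running intersection relaxation, since the first set in the ordering forces \<open>w\<^sub>k = {}\<close> and so
  makes the right-hand side large enough (\<open>half_point_in_MP_RI\<close>).  But for three nodes in a common
  clique the triangle inequality
  \<open>z\<^sub>a + z\<^sub>b + z\<^sub>c - z\<^sub>a\<^sub>b - z\<^sub>a\<^sub>c - z\<^sub>b\<^sub>c \<le> 1\<close> holds on the clique relaxation and fails at this point
  (\<open>MP_cl_triangle\<close>).
\<close>

section \<open>Valid inequalities for the clique relaxation\<close>

lemma linear_coordinate: "linear (\<lambda>x :: 'i \<Rightarrow> real. x i)"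
  by (rule linearI) (simp_all add: scaleR_fun_def)

lemma MP_linear_le:
  fixes L :: "('a set \<Rightarrow> real) \<Rightarrow> real"
  assumes "linear L" and "\<And>x. x \<in> multilinear_set G \<Longrightarrow> L x \<le> b" and "x \<in> MP G"
  shows "L x \<le> b"
proof -
  have "convex {x. L x \<le> b}"
  proof -
    have "convex (L -` {..b})"
      using assms(1) by (intro convex_linear_vimage) auto
    then show ?thesis by (simp add: vimage_def)
  qed
  then have "MP G \<subseteq> {x. L x \<le> b}"
    unfolding MP_def using assms(2) by (intro hull_minimal) auto
  with assms(3) show ?thesis by blast
qed

lemma coords_complete_hg:
  assumes "finite C"
  shows "S \<in> coords (complete_hg C) \<longleftrightarrow> S \<subseteq> C \<and> S \<noteq> {}"
proof -
  have "card S \<ge> 2 \<or> (\<exists>v. S = {v})" if "S \<subseteq> C" "S \<noteq> {}"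
  proof -
    have "card S \<noteq> 0" using that assms finite_subset by fastforce
    then have "card S = 1 \<or> card S \<ge> 2" by linarith
    then show ?thesis by (metis card_1_singletonE)
  qed
  then show ?thesis
    by (auto simp: coords_def complete_hg_def subsets_ge2_def)
qed

text \<open>
  Identifying a node with its singleton makes the product formula uniform over all nonempty sets.
\<close>
lemma multilinear_set_complete_hg:
  assumes "finite C" and x: "x \<in> multilinear_set (complete_hg C)"
    and S: "S \<subseteq> C" "S \<noteq> {}"
  shows "x S = of_bool (\<forall>v\<in>S. x {v} = 1)"
proof -
  have fin: "finite S" using assms finite_subset by blast
  have bin: "x {v} \<in> {0, 1}" if "v \<in> S" for v
    using x S that coords_complete_hg[OF assms(1), of "{v}"]
    by (auto simp: multilinear_set_def)
  have "x S = (\<Prod>v\<in>S. x {v})"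
  proof (cases "\<exists>v. S = {v}")
    case False
    then have "S \<in> edges (complete_hg C)"
      using S coords_complete_hg[OF assms(1), of S] by (auto simp: coords_def complete_hg_def)
    then show ?thesis using x by (simp add: multilinear_set_def)
  qed auto
  also have "\<dots> = of_bool (\<forall>v\<in>S. x {v} = 1)"
    using bin fin by (auto simp: prod_zero_iff)
  finally show ?thesis .
qed

lemma finite_maximal_clique:
  "finite_graph V E \<Longrightarrow> C \<in> maximal_cliques V E \<Longrightarrow> finite C"
  by (auto simp: finite_graph_def maximal_cliques_def intro: finite_subset)

text \<open>
  Inequalities for the clique relaxation come from 0/1 points of one clique; the last hypothesis says
  that the left-hand side reads only coordinates of that clique.
\<close>
lemma MP_cl_linear_le:
  fixes L :: "('a set \<Rightarrow> real) \<Rightarrow> real"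
  assumes "finite_graph V E" and z: "z \<in> MP_cl V E" and C: "C \<in> maximal_cliques V E"
    and "linear L" and "\<And>x. x \<in> multilinear_set (complete_hg C) \<Longrightarrow> L x \<le> b"
    and local: "\<And>x y. (\<And>S. S \<subseteq> C \<Longrightarrow> S \<noteq> {} \<Longrightarrow> x S = y S) \<Longrightarrow> L x = L y"
  shows "L z \<le> b"
proof -
  have "L z = L (restrict_coords (complete_hg C) z)"
    by (rule local)
      (simp add: restrict_coords_def coords_complete_hg finite_maximal_clique[OF assms(1) C])
  also have "\<dots> \<le> b"
    using z C MP_linear_le[OF assms(4,5)] by (auto simp: MP_cl_def)
  finally show ?thesis .
qed

lemma ugm_edge_in_clique:
  assumes "e \<in> edges (ugm_hg V E)"
  obtains C where "C \<in> maximal_cliques V E" "e \<subseteq> C"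
  using assms by (auto simp: ugm_hg_def subsets_ge2_def)

lemma ugm_edge_props:
  assumes "finite_graph V E" "e \<in> edges (ugm_hg V E)"
  shows "e \<subseteq> V" "card e \<ge> 2" "finite e" "e \<noteq> {}"
proof -
  show "e \<subseteq> V" "card e \<ge> 2"
    using hypergraph_ugm_hg[OF assms(1)] assms(2) by (auto simp: hypergraph_def ugm_hg_def)
  then show "finite e" "e \<noteq> {}"
    using card.infinite by force+
qed

lemma MP_cl_antimono:
  assumes fg: "finite_graph V E" and z: "z \<in> MP_cl V E" and C: "C \<in> maximal_cliques V E"
    and "S \<subseteq> S'" "S' \<subseteq> C" "S \<noteq> {}"
  shows "z S' \<le> z S"
proof -
  have ne: "S' \<noteq> {}" "S \<subseteq> C" using assms by auto
  have "z S' - z S \<le> 0"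
  proof (rule MP_cl_linear_le[OF fg z C, where L = "\<lambda>x. x S' - x S"])
    show "linear (\<lambda>x :: _ \<Rightarrow> real. x S' - x S)"
      by (intro linear_compose_sub linear_coordinate)
  next
    fix x assume "x \<in> multilinear_set (complete_hg C)"
    note x = multilinear_set_complete_hg[OF finite_maximal_clique[OF fg C] this]
    show "x S' - x S \<le> 0"
      using x[of S'] x[of S] assms ne by (auto simp: of_bool_def)
  qed (use assms ne in auto)
  then show ?thesis by simp
qed

section \<open>Running intersection inequalities\<close>

lemma sum_mono_unit_gap:
  fixes g h :: "'b \<Rightarrow> real"
  assumes "finite A" "j \<in> A" "g j + 1 \<le> h j" "\<And>i. i \<in> A \<Longrightarrow> g i \<le> h i"
  shows "sum g A + 1 \<le> sum h A"
proof -
  have "sum g (A - {j}) \<le> sum h (A - {j})" using assms by (intro sum_mono) auto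
  then show ?thesis using assms by (simp add: sum.remove)
qed

text \<open>
  Every summand on the left is at most its share of the right-hand side without the \<open>-1\<close>, because
  \<open>w\<^sub>k \<subseteq> f\<^sub>k\<close>; so a single gap of one is all that is needed.  Either \<open>x\<^bsub>e\<^sub>0\<^esub> = 1\<close> is that gap, or some
  node of \<open>e\<^sub>0\<close> is zero.  If this node lies in no \<open>f\<^sub>k\<close>, it is the gap itself.  Otherwise the gap is
  at the first set in the list whose value is zero: all earlier sets have value one and they cover
  \<open>w\<^sub>k\<close>.
\<close>
lemma ri_inequality_01:
  fixes x :: "'a set \<Rightarrow> real" and T :: "'k set"
  assumes C: "finite C" and x: "x \<in> multilinear_set (complete_hg C)"
    and e0: "e0 \<subseteq> C" "e0 \<noteq> {}" and T: "finite T"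
    and f: "\<And>k. k \<in> T \<Longrightarrow> f k \<subseteq> e0 \<and> f k \<noteq> {}"
    and ps: "distinct ps" "set ps = f ` T"
    and w: "\<And>k. k \<in> T \<Longrightarrow> w k \<subseteq> ri_induced ps (f k)"
  shows "- (\<Sum>k\<in>T. if w k = {} then 0 else x (w k)) + (\<Sum>v\<in>e0 - (\<Union>k\<in>T. f k). x {v})
      + (\<Sum>k\<in>T. x (f k)) - x e0
    \<le> real (card (e0 - (\<Union>k\<in>T. f k))) + real (card {k\<in>T. w k = {}}) - 1"
proof -
  note val = multilinear_set_complete_hg[OF C x]
  define A where "A = e0 - (\<Union>k\<in>T. f k)"
  define d where "d k = x (f k) - (if w k = {} then 0 else x (w k))" for k
  define u :: "'k \<Rightarrow> real" where "u k = of_bool (w k = {})" for k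
  have finA: "finite A" using C e0 by (auto simp: A_def intro: finite_subset)
  have fC: "f k \<subseteq> C" "f k \<noteq> {}" if "k \<in> T" for k using f[OF that] e0 by auto
  have wf: "w k \<subseteq> f k" if "k \<in> T" for k
    using w[OF that] by (auto simp: ri_induced_def)
  have node_le: "x {v} \<le> 1" if "v \<in> A" for v
    using val[of "{v}"] that e0 by (auto simp: A_def)
  have d_le: "d k \<le> u k" if "k \<in> T" for k
  proof (cases "w k = {}")
    case True
    then show ?thesis using val[OF fC[OF that]] by (simp add: d_def u_def)
  next
    case False
    then show ?thesis
      using val[OF fC[OF that]] val[of "w k"] wf[OF that] fC[OF that]
      by (auto simp: d_def u_def of_bool_def)
  qed
  have sum_u: "sum u T = real (card {k\<in>T. w k = {}})"
    using T by (simp add: u_def sum.If_cases of_bool_def Int_def conj_commute)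
  have sum_A: "(\<Sum>v\<in>A. x {v}) \<le> real (card A)"
    using sum_mono[of A "\<lambda>v. x {v}" "\<lambda>_. 1"] node_le by simp
  have sum_d: "sum d T \<le> sum u T" by (rule sum_mono) (rule d_le)
  have "sum d T + (\<Sum>v\<in>A. x {v}) - x e0 \<le> real (card A) + sum u T - 1"
  proof (cases "x e0 = 1")
    case True
    then show ?thesis using sum_A sum_d by simp
  next
    case False
    then have xe0: "x e0 = 0" using val[of e0] e0 by (auto simp: of_bool_def split: if_splits)
    then obtain v where v: "v \<in> e0" "x {v} \<noteq> 1"
      using val[of e0] e0 by (auto simp: of_bool_def split: if_splits)
    then have v0: "x {v} = 0"
      using val[of "{v}"] e0 by (auto simp: of_bool_def split: if_splits)
    show ?thesis
    proof (cases "v \<in> A")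
      case True
      then have "(\<Sum>v\<in>A. x {v}) + 1 \<le> (\<Sum>v\<in>A. 1)"
        using finA v0 node_le by (intro sum_mono_unit_gap[where j = v]) auto
      then show ?thesis using sum_d xe0 by simp
    next
      case False
      then obtain k0 where k0: "k0 \<in> T" "v \<in> f k0" using v by (auto simp: A_def)
      then obtain i0 where i0: "i0 < length ps" "ps ! i0 = f k0"
        using ps by (metis imageI in_set_conv_nth)
      define P where "P i \<longleftrightarrow> i < length ps \<and> (\<exists>v\<in>ps ! i. x {v} \<noteq> 1)" for i
      have "P i0" using i0 k0 v by (auto simp: P_def)
      define i where "i = (LEAST i. P i)"
      have Pi: "P i" using \<open>P i0\<close> by (simp add: i_def LeastI)
      have before: "x {v} = 1" if "j < i" "v \<in> ps ! j" for j v
        using not_less_Least[of j P] that Pi unfolding i_def[symmetric] by (auto simp: P_def)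
      obtain k where k: "k \<in> T" "ps ! i = f k"
        using Pi ps by (metis P_def imageE nth_mem)
      have "x (f k) = 0" using val[OF fC[OF k(1)]] Pi k by (auto simp: P_def)
      moreover have "x (w k) = 1" if "w k \<noteq> {}"
      proof -
        have "w k \<subseteq> (\<Union>j<i. ps ! j)"
          using w[OF k(1)] ri_induced_nth[OF ps(1), of i] Pi k(2) by (auto simp: P_def)
        then have "\<forall>v\<in>w k. x {v} = 1" using before by auto
        then show ?thesis using val[of "w k"] wf[OF k(1)] fC[OF k(1)] that by auto
      qed
      ultimately have "d k + 1 \<le> u k" by (simp add: d_def u_def)
      then have "sum d T + 1 \<le> sum u T"
        using T k d_le by (intro sum_mono_unit_gap[where j = k]) auto
      then show ?thesis using sum_A xe0 by simp
    qed
  qed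
  moreover have "sum d T = (\<Sum>k\<in>T. x (f k)) - (\<Sum>k\<in>T. if w k = {} then 0 else x (w k))"
    by (simp add: d_def sum_subtractf)
  ultimately show ?thesis unfolding A_def[symmetric] sum_u[symmetric] by linarith
qed

text \<open>
  Stated for an arbitrary enumeration \<open>ps\<close> and an arbitrary finite \<open>T\<close>, so that it also yields the
  flower inequalities (all \<open>w\<^sub>k\<close> empty) and, for \<open>T = {}\<close>, the lower bound of the standard
  linearization.  Cutting a neighbor off at \<open>e\<^sub>0\<close> can only increase its coordinate, and it brings the
  whole left-hand side into a single clique containing \<open>e\<^sub>0\<close>.
\<close>
lemma MP_cl_ri_inequality:
  assumes fg: "finite_graph V E" and z: "z \<in> MP_cl V E"
    and e0: "e0 \<in> edges (ugm_hg V E)" and T: "finite T"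
    and e: "\<And>k. k \<in> T \<Longrightarrow> e k \<in> edges (ugm_hg V E) \<and> e0 \<inter> e k \<noteq> {}"
    and ps: "distinct ps" "set ps = (\<lambda>k. e0 \<inter> e k) ` T"
    and w: "\<And>k. k \<in> T \<Longrightarrow> w k \<subseteq> ri_induced ps (e0 \<inter> e k)"
  shows "- (\<Sum>k\<in>T. if w k = {} then 0 else z (w k)) + (\<Sum>v\<in>e0 - (\<Union>k\<in>T. e k). z {v})
      + (\<Sum>k\<in>T. z (e k)) - z e0
    \<le> real (card (e0 - (\<Union>k\<in>T. e k))) + real (card {k\<in>T. w k = {}}) - 1"
proof -
  obtain C where C: "C \<in> maximal_cliques V E" "e0 \<subseteq> C" using ugm_edge_in_clique[OF e0] .
  have ne: "e0 \<noteq> {}" using ugm_edge_props[OF fg e0] by simp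
  define f where "f k = e0 \<inter> e k" for k
  define A where "A = e0 - (\<Union>k\<in>T. f k)"
  have A: "e0 - (\<Union>k\<in>T. e k) = A" by (auto simp: A_def f_def)
  have f: "f k \<subseteq> e0 \<and> f k \<noteq> {}" if "k \<in> T" for k using e[OF that] by (auto simp: f_def)
  have psf: "set ps = f ` T" using ps(2) unfolding f_def .
  have wf: "w k \<subseteq> ri_induced ps (f k)" if "k \<in> T" for k using w[OF that] by (simp add: f_def)
  have wC: "w k \<subseteq> C" if "k \<in> T" for k
    using wf[OF that] f[OF that] C by (auto simp: ri_induced_def)
  let ?L = "\<lambda>x. - (\<Sum>k\<in>T. if w k = {} then 0 else x (w k)) + (\<Sum>v\<in>A. x {v})
      + (\<Sum>k\<in>T. x (f k)) - x e0 :: real"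
  have "?L z \<le> real (card A) + real (card {k\<in>T. w k = {}}) - 1"
  proof (rule MP_cl_linear_le[OF fg z C(1), where L = ?L])
    have "linear (\<lambda>x :: _ \<Rightarrow> real. if w k = {} then 0 else x (w k))" for k
      by (cases "w k = {}") (simp_all add: linear_zero linear_coordinate)
    then show "linear ?L"
      by (intro linear_compose_sub linear_compose_add linear_compose_neg linear_compose_sum
          ballI linear_coordinate)
  next
    fix x assume "x \<in> multilinear_set (complete_hg C)"
    from ri_inequality_01[OF finite_maximal_clique[OF fg C(1)] this C(2) ne T f ps(1) psf wf]
    show "?L x \<le> real (card A) + real (card {k\<in>T. w k = {}}) - 1"
      unfolding A_def .
  next
    fix x y :: "'a set \<Rightarrow> real"
    assume eq: "\<And>S. S \<subseteq> C \<Longrightarrow> S \<noteq> {} \<Longrightarrow> x S = y S"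
    have "(\<Sum>k\<in>T. if w k = {} then 0 else x (w k)) = (\<Sum>k\<in>T. if w k = {} then 0 else y (w k))"
      using eq wC by (intro sum.cong) auto
    moreover have "(\<Sum>v\<in>A. x {v}) = (\<Sum>v\<in>A. y {v})"
      using eq C(2) by (intro sum.cong) (auto simp: A_def)
    moreover have "(\<Sum>k\<in>T. x (f k)) = (\<Sum>k\<in>T. y (f k))"
      using eq C(2) f by (intro sum.cong refl) (meson order_trans)
    ultimately show "?L x = ?L y" using eq[OF C(2) ne] by simp
  qed
  moreover have "(\<Sum>k\<in>T. z (e k)) \<le> (\<Sum>k\<in>T. z (f k))"
  proof (rule sum_mono)
    fix k assume k: "k \<in> T"
    then obtain D where D: "D \<in> maximal_cliques V E" "e k \<subseteq> D"
      using e ugm_edge_in_clique by metis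
    show "z (e k) \<le> z (f k)"
      using f[OF k] by (intro MP_cl_antimono[OF fg z D(1) _ D(2)]) (auto simp: f_def)
  qed
  ultimately show ?thesis unfolding A by linarith
qed

section \<open>Containment\<close>

lemma MP_cl_subset_MP_LP:
  assumes fg: "finite_graph V E"
  shows "MP_cl V E \<subseteq> MP_LP (ugm_hg V E)"
proof
  fix z assume z: "z \<in> MP_cl V E"
  have "z {v} \<le> 1" if v: "v \<in> V" for v
  proof -
    obtain C where C: "C \<in> maximal_cliques V E" "{v} \<subseteq> C"
      using ex_maximal_clique[of V "{v}" E] v fg by (auto simp: finite_graph_def clique_def)
    show ?thesis
    proof (rule MP_cl_linear_le[OF fg z C(1), where L = "\<lambda>x. x {v}"])
      fix x assume "x \<in> multilinear_set (complete_hg C)"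
      from multilinear_set_complete_hg[OF finite_maximal_clique[OF fg C(1)] this C(2)]
      show "x {v} \<le> 1" by (simp add: of_bool_def split: if_splits)
    qed (use C in \<open>auto intro: linear_coordinate\<close>)
  qed
  moreover have "z e \<ge> 0" "z e \<ge> (\<Sum>v\<in>e. z {v}) - real (card e) + 1" "\<forall>v\<in>e. z e \<le> z {v}"
    if e: "e \<in> edges (ugm_hg V E)" for e
  proof -
    obtain C where C: "C \<in> maximal_cliques V E" "e \<subseteq> C" using ugm_edge_in_clique[OF e] .
    note e' = ugm_edge_props[OF fg e]
    note val = multilinear_set_complete_hg[OF finite_maximal_clique[OF fg C(1)]]
    have "- z e \<le> 0"
    proof (rule MP_cl_linear_le[OF fg z C(1), where L = "\<lambda>x. - x e"])
      show "linear (\<lambda>x :: _ \<Rightarrow> real. - x e)"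
        by (intro linear_compose_neg linear_coordinate)
      show "- x e \<le> 0" if "x \<in> multilinear_set (complete_hg C)" for x
        using val[OF that C(2) e'(4)] by simp
    qed (use C e' in auto)
    then show "z e \<ge> 0" by simp
    \<comment> \<open>Without neighbors, the running intersection inequality is this lower bound.\<close>
    show "z e \<ge> (\<Sum>v\<in>e. z {v}) - real (card e) + 1"
      using MP_cl_ri_inequality[OF fg z e, of "{}" "\<lambda>_. {}" "[]" "\<lambda>_. {}"] by simp
    show "\<forall>v\<in>e. z e \<le> z {v}"
      using MP_cl_antimono[OF fg z C(1) _ C(2)] by auto
  qed
  moreover have "nodes (ugm_hg V E) = V" by (simp add: ugm_hg_def)
  ultimately show "z \<in> MP_LP (ugm_hg V E)"
    using z unfolding MP_LP_def MP_cl_def by blast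
qed

lemma MP_cl_subset_MP_F:
  assumes fg: "finite_graph V E"
  shows "MP_cl V E \<subseteq> MP_F (ugm_hg V E)"
proof
  fix z assume z: "z \<in> MP_cl V E"
  have "(\<Sum>v\<in>e0 - (\<Union>k\<in>T. e k). z {v}) + (\<Sum>k\<in>T. z (e k)) - z e0
      \<le> real (card (e0 - (\<Union>k\<in>T. e k))) + real (card T) - 1"
    if fl: "flower (ugm_hg V E) e0 T e" for e0 T e
  proof -
    have T: "finite T" using fl by (simp add: flower_def)
    then obtain ps where ps: "set ps = (\<lambda>k. e0 \<inter> e k) ` T" "distinct ps"
      using finite_distinct_list[of "(\<lambda>k. e0 \<inter> e k) ` T"] by auto
    have "e k \<in> edges (ugm_hg V E) \<and> e0 \<inter> e k \<noteq> {}" if "k \<in> T" for k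
      using fl that by (force simp: flower_def)
    from MP_cl_ri_inequality[OF fg z _ T this ps(2,1), where w = "\<lambda>_. {}"] fl
    show ?thesis by (simp add: flower_def)
  qed
  then show "z \<in> MP_F (ugm_hg V E)"
    using z MP_cl_subset_MP_LP[OF fg] by (auto simp: MP_F_def)
qed

lemma MP_cl_subset_MP_RI:
  assumes fg: "finite_graph V E"
  shows "MP_cl V E \<subseteq> MP_RI (ugm_hg V E)"
proof
  fix z assume z: "z \<in> MP_cl V E"
  have "- (\<Sum>k\<in>T. if w k = {} then 0 else z (w k))
          + (\<Sum>v\<in>e0 - (\<Union>k\<in>T. e k). z {v}) + (\<Sum>k\<in>T. z (e k)) - z e0
          \<le> real (card (e0 - (\<Union>k\<in>T. e k))) + real (card {k\<in>T. w k = {}}) - 1"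
    if ri: "ri_neighbors (ugm_hg V E) e0 T e" "ri_ordering ps ((\<lambda>k. e0 \<inter> e k) ` T)"
      "ri_choice (ugm_hg V E) e0 T e ps w" for e0 T e ps w
  proof (rule MP_cl_ri_inequality[OF fg z])
    show "e k \<in> edges (ugm_hg V E) \<and> e0 \<inter> e k \<noteq> {}" if "k \<in> T" for k
      using ri(1) that by (force simp: ri_neighbors_def)
  qed (use ri in \<open>auto simp: ri_neighbors_def ri_ordering_def ri_choice_def\<close>)
  then show "z \<in> MP_RI (ugm_hg V E)"
    using z MP_cl_subset_MP_F[OF fg] by (auto simp: MP_RI_def)
qed

section \<open>A point outside the clique relaxation\<close>

definition half_point :: "'a set \<Rightarrow> 'a set \<Rightarrow> real"
  where "half_point V S = (if \<exists>v\<in>V. S = {v} then 1 / 2 else 0)"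

lemma half_point_edge:
  assumes "card e \<ge> 2"
  shows "half_point V e = 0"
  using assms by (auto simp: half_point_def)

lemma half_point_node_sum:
  assumes "A \<subseteq> V"
  shows "(\<Sum>v\<in>A. half_point V {v}) = real (card A) / 2"
proof -
  have "(\<Sum>v\<in>A. half_point V {v}) = (\<Sum>v\<in>A. 1 / 2)"
    using assms by (intro sum.cong) (auto simp: half_point_def)
  then show ?thesis by simp
qed

lemma half_point_in_MP_LP:
  assumes fg: "finite_graph V E"
  shows "half_point V \<in> MP_LP (ugm_hg V E)"
proof -
  have "half_point V \<in> coord_space (ugm_hg V E)"
    by (auto simp: coord_space_def coords_def ugm_hg_def half_point_def)
  moreover have "half_point V e = 0" "(\<Sum>v\<in>e. half_point V {v}) - real (card e) + 1 \<le> 0"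
    if e: "e \<in> edges (ugm_hg V E)" for e
    using ugm_edge_props[OF fg e]
    by (auto simp: half_point_edge half_point_node_sum)
  ultimately show ?thesis by (auto simp: MP_LP_def half_point_def)
qed

lemma half_point_in_MP_F:
  assumes fg: "finite_graph V E"
  shows "half_point V \<in> MP_F (ugm_hg V E)"
proof -
  have "(\<Sum>v\<in>e0 - (\<Union>k\<in>T. e k). half_point V {v}) + (\<Sum>k\<in>T. half_point V (e k)) - half_point V e0
      \<le> real (card (e0 - (\<Union>k\<in>T. e k))) + real (card T) - 1"
    if fl: "flower (ugm_hg V E) e0 T e" for e0 T e
  proof -
    have "half_point V (e k) = 0" if "k \<in> T" for k
      using fl that ugm_edge_props[OF fg] by (auto simp: flower_def half_point_edge)
    moreover have "e0 \<subseteq> V" "half_point V e0 = 0"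
      using fl ugm_edge_props[OF fg] by (auto simp: flower_def half_point_edge)
    moreover have "card T \<ge> 1" using fl by (auto simp: flower_def Suc_le_eq card_gt_0_iff)
    moreover have "(\<Sum>v\<in>e0 - (\<Union>k\<in>T. e k). half_point V {v})
        = real (card (e0 - (\<Union>k\<in>T. e k))) / 2"
      using calculation(2) by (intro half_point_node_sum) auto
    ultimately show ?thesis by simp
  qed
  then show ?thesis using half_point_in_MP_LP[OF fg] by (auto simp: MP_F_def)
qed

lemma half_point_in_MP_RI:
  assumes fg: "finite_graph V E"
  shows "half_point V \<in> MP_RI (ugm_hg V E)"
proof -
  let ?z = "half_point V"
  have "- (\<Sum>k\<in>T. if w k = {} then 0 else ?z (w k))
          + (\<Sum>v\<in>e0 - (\<Union>k\<in>T. e k). ?z {v}) + (\<Sum>k\<in>T. ?z (e k)) - ?z e0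
          \<le> real (card (e0 - (\<Union>k\<in>T. e k))) + real (card {k\<in>T. w k = {}}) - 1"
    if ri: "ri_neighbors (ugm_hg V E) e0 T e" "ri_ordering ps ((\<lambda>k. e0 \<inter> e k) ` T)"
      "ri_choice (ugm_hg V E) e0 T e ps w" for e0 T e ps w
  proof -
    have T: "finite T" "T \<noteq> {}" using ri(1) by (auto simp: ri_neighbors_def)
    have e: "?z (e k) = 0" if "k \<in> T" for k
      using ri(1) that ugm_edge_props[OF fg] by (auto simp: ri_neighbors_def half_point_edge)
    have e0: "e0 \<subseteq> V" "?z e0 = 0"
      using ri(1) ugm_edge_props[OF fg] by (auto simp: ri_neighbors_def half_point_edge)
    \<comment> \<open>Nothing precedes the first set of the ordering, so its choice \<open>w\<close> must be empty.\<close>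
    obtain p qs where p: "ps = p # qs" "p \<in> (\<lambda>k. e0 \<inter> e k) ` T"
      using ri(2) T(2) by (cases ps) (auto simp: ri_ordering_def)
    then obtain k where k: "k \<in> T" "p = e0 \<inter> e k" by auto
    then have "w k = {}" using ri(3) p(1) by (auto simp: ri_choice_def ri_induced_def)
    then have "card {k\<in>T. w k = {}} \<ge> 1"
      using T k by (auto simp: Suc_le_eq card_gt_0_iff)
    moreover have "(\<Sum>k\<in>T. if w k = {} then 0 else ?z (w k)) \<ge> 0"
      by (intro sum_nonneg) (auto simp: half_point_def)
    moreover have "(\<Sum>v\<in>e0 - (\<Union>k\<in>T. e k). ?z {v}) = real (card (e0 - (\<Union>k\<in>T. e k))) / 2"
      using e0(1) by (intro half_point_node_sum) auto
    ultimately show ?thesis using e e0 by simp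
  qed
  then show ?thesis using half_point_in_MP_F[OF fg] by (auto simp: MP_RI_def)
qed

text \<open>
  With \<open>s\<close> of the three nodes equal to one, the left-hand side is \<open>s - s (s - 1) / 2\<close>, which is at
  most one for every integer \<open>s\<close>.
\<close>
lemma MP_cl_triangle:
  assumes fg: "finite_graph V E" and z: "z \<in> MP_cl V E" and C: "C \<in> maximal_cliques V E"
    and abc: "{a, b, c} \<subseteq> C"
  shows "z {a} + z {b} + z {c} - z {a, b} - z {a, c} - z {b, c} \<le> 1"
proof (rule MP_cl_linear_le[OF fg z C,
      where L = "\<lambda>x. x {a} + x {b} + x {c} - x {a, b} - x {a, c} - x {b, c}"])
  show "linear (\<lambda>x :: _ \<Rightarrow> real. x {a} + x {b} + x {c} - x {a, b} - x {a, c} - x {b, c})"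
    by (intro linear_compose_sub linear_compose_add linear_coordinate)
next
  fix x assume "x \<in> multilinear_set (complete_hg C)"
  note x = multilinear_set_complete_hg[OF finite_maximal_clique[OF fg C] this]
  show "x {a} + x {b} + x {c} - x {a, b} - x {a, c} - x {b, c} \<le> 1"
    using x[of "{a}"] x[of "{b}"] x[of "{c}"] x[of "{a, b}"] x[of "{a, c}"] x[of "{b, c}"] abc
    by (auto simp: of_bool_def split: if_splits)
qed (use abc in auto)

lemma half_point_not_in_MP_cl:
  assumes fg: "finite_graph V E" and C: "C \<in> maximal_cliques V E" and "card C \<ge> 3"
  shows "half_point V \<notin> MP_cl V E"
proof
  assume z: "half_point V \<in> MP_cl V E"
  obtain S where "S \<subseteq> C" "card S = 3"
    using obtain_subset_with_card_n[OF assms(3)] by blast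
  then obtain a b c where abc: "{a, b, c} \<subseteq> C" "a \<noteq> b" "a \<noteq> c" "b \<noteq> c"
    by (auto simp: card_3_iff)
  moreover have "a \<in> V" "b \<in> V" "c \<in> V"
    using C abc(1) by (auto simp: maximal_cliques_def)
  ultimately show False
    using MP_cl_triangle[OF fg z C abc(1)] by (auto simp: half_point_def)
qed

theorem proposition3:
  fixes V :: "'a set" and E :: "'a set set"
  assumes "finite_graph V E"
    and "rank_hg (ugm_hg V E) \<ge> 3"
  shows "MP_cl V E \<subset> MP_RI (ugm_hg V E)"
proof -
  have ne: "edges (ugm_hg V E) \<noteq> {}"
    using assms(2) by (auto simp: rank_hg_def)
  have "edges (ugm_hg V E) \<subseteq> Pow V"
    using ugm_edge_props(1)[OF assms(1)] by blast
  then have "finite (edges (ugm_hg V E))"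
    using assms(1) by (auto simp: finite_graph_def intro: finite_subset)
  then have "Max (card ` edges (ugm_hg V E)) \<in> card ` edges (ugm_hg V E)"
    using ne by (intro Max_in) auto
  then obtain e where e: "e \<in> edges (ugm_hg V E)" "card e \<ge> 3"
    using assms(2) ne by (auto simp: rank_hg_def)
  obtain C where C: "C \<in> maximal_cliques V E" "e \<subseteq> C" using ugm_edge_in_clique[OF e(1)] .
  have "card C \<ge> 3"
    using card_mono[OF finite_maximal_clique[OF assms(1) C(1)] C(2)] e(2) by linarith
  then show ?thesis
    using MP_cl_subset_MP_RI[OF assms(1)] half_point_in_MP_RI[OF assms(1)]
      half_point_not_in_MP_cl[OF assms(1) C(1)] by blast
qed

end
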